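(* Let $N\ge1$, let $\boldsymbol{X}\sim\mathcal{N}(\mathbf{m},\mathsf{\Sigma})$ be a Gaussian random vector in $\mathbb{R}^N$ with $\mathsf{\Sigma}$ symmetric positive definite, let $\mathsf{A}\in\mathbb{R}^{N\times N}$ be symmetric positive definite, $\mathbf{c}\in\mathbb{R}^N$ and $\rho>0$, and consider the ellipsoid $$\mathcal{E}(\mathsf{A},\mathbf{c},\rho)=\{\mathbf{x}\in\mathbb{R}^N:(\mathbf{x}-\mathbf{c})^{\mathrm T}\mathsf{A}(\mathbf{x}-\mathbf{c})\le\rho\}.$$ Let $\mathsf{\Sigma}^{1/2}\mathsf{A}\mathsf{\Sigma}^{1/2}=\mathsf{P}\mathsf{\Omega}\mathsf{P}^{\mathrm T}$ with $\mathsf{P}\in\mathbb{R}^{N\times N}$ orthogonal and $\mathsf{\Omega}=\mathrm{diag}(\omega_1,\dots,\omega_N)$, $\omega_i>0$, and let $(\nu_1,\dots,\nu_N)^{\mathrm T}=\mathsf{P}^{\mathrm T}\mathsf{\Sigma}^{-1/2}(\mathbf{m}-\mathbf{c})$. Then $$\Pr\{\boldsymbol{X}\in\mathcal{E}(\mathsf{A},\mathbf{c},\rho)\}=F_Z(\rho),$$ where $F_Z(z)=\Pr\{Z\le z\}$ is the cumulative distribution function of the generalized chi-squared random variable $Z=\sum_{i=1}^N\omega_iW_i$, with $W_1,\dots,W_N$ independent and $W_i\sim\chi^2(1,\nu_i^2)$ for $i=1,\dots,N$.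
   Context: $\mathsf{\Sigma}^{1/2}$ is the symmetric positive definite square root of $\mathsf{\Sigma}$ and $\mathsf{\Sigma}^{-1/2}$ its inverse. $\chi^2(1,\nu^2)$ denotes the noncentral chi-square distribution with one degree of freedom and noncentrality parameter $\nu^2$, i.e. the law of $(G+\nu)^2$ with $G$ standard normal. *)

theory Defs
  imports "HOL-Probability.Probability"
begin

definition sym_posdef :: "real^'n^'n \<Rightarrow> bool" where
  "sym_posdef A \<longleftrightarrow> transpose A = A \<and> (\<forall>x. x \<noteq> 0 \<longrightarrow> 0 < x \<bullet> (A *v x))"

definition diag_matrix :: "('n \<Rightarrow> real) \<Rightarrow> real^'n^'n" where
  "diag_matrix d = (\<chi> i j. if i = j then d i else 0)"

(* Meaningful only for symmetric positive definite S, where the root exists and is unique. *)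
definition posdef_sqrt :: "real^'n^'n \<Rightarrow> real^'n^'n" where
  "posdef_sqrt S = (THE R. sym_posdef R \<and> R ** R = S)"

definition mvn_density :: "real^'n \<Rightarrow> real^'n^'n \<Rightarrow> real^'n \<Rightarrow> real" where
  "mvn_density m S x =
     exp (- ((x - m) \<bullet> (matrix_inv S *v (x - m))) / 2) / sqrt ((2 * pi) ^ CARD('n) * det S)"

(* X ~ N(m, S) under the probability measure M, in the nondegenerate case S positive definite. *)
definition gaussian_vector ::
    "'a measure \<Rightarrow> ('a \<Rightarrow> real^'n) \<Rightarrow> real^'n \<Rightarrow> real^'n^'n \<Rightarrow> bool" where
  "gaussian_vector M X m S \<longleftrightarrow> distributed M lborel X (\<lambda>x. ennreal (mvn_density m S x))"

definition ellipsoid :: "real^'n^'n \<Rightarrow> real^'n \<Rightarrow> real \<Rightarrow> (real^'n) set" where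
  "ellipsoid A c \<rho> = {x. (x - c) \<bullet> (A *v (x - c)) \<le> \<rho>}"

(* The argument is the noncentrality parameter itself, assumed nonnegative.  That the law of
   (G + nu)^2 depends only on nu^2, so that this is well defined, is the lemma below. *)
definition noncentral_chi_square1 :: "real \<Rightarrow> real measure" where
  "noncentral_chi_square1 l =
     distr (density lborel (\<lambda>g. ennreal (std_normal_density g))) borel (\<lambda>g. (g + sqrt l)\<^sup>2)"

lemma std_normal_reflect:
  "distr (density lborel (\<lambda>g. ennreal (std_normal_density g))) borel uminus
   = density lborel (\<lambda>g. ennreal (std_normal_density g))"
proof -
  have "distributed (density lborel (\<lambda>g. ennreal (std_normal_density g))) lborel
          (\<lambda>x. x) (\<lambda>g. ennreal (std_normal_density g))"
    by (auto simp: distributed_def intro!: distr_id2)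
  then have "distributed (density lborel (\<lambda>g. ennreal (std_normal_density g))) lborel
          (\<lambda>x. 0 + (-1) * x) (\<lambda>g. ennreal (normal_density (0 + (-1) * 0) (\<bar>-1\<bar> * 1) g))"
    by (intro prob_space.normal_density_affine prob_space_normal_density) auto
  then show ?thesis
    by (simp add: distributed_def cong: distr_cong)
qed

lemma noncentral_chi_square1_power2:
  "noncentral_chi_square1 (\<nu>\<^sup>2) =
     distr (density lborel (\<lambda>g. ennreal (std_normal_density g))) borel (\<lambda>g. (g + \<nu>)\<^sup>2)"
proof (cases "0 \<le> \<nu>")
  case True
  then show ?thesis by (simp add: noncentral_chi_square1_def)
next
  case False
  let ?N = "density lborel (\<lambda>g. ennreal (std_normal_density g))"
  have "distr ?N borel (\<lambda>g. (g + \<nu>)\<^sup>2) = distr (distr ?N borel uminus) borel (\<lambda>g. (g + \<nu>)\<^sup>2)"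
    by (simp only: std_normal_reflect)
  also have "\<dots> = distr ?N borel ((\<lambda>g. (g + \<nu>)\<^sup>2) \<circ> uminus)"
    by (rule distr_distr) auto
  also have "(\<lambda>g. (g + \<nu>)\<^sup>2) \<circ> uminus = (\<lambda>g. (g + sqrt (\<nu>\<^sup>2))\<^sup>2)"
    using False by (auto simp: fun_eq_iff power2_eq_square algebra_simps)
  finally show ?thesis by (simp add: noncentral_chi_square1_def)
qed

end

theory Submission
  imports Defs
begin

text \<open>
  With \<open>G = \<Sigma>\<^sup>1\<^sup>/\<^sup>2 P\<close> we have \<open>G G\<^sup>T = \<Sigma>\<close>, so \<open>X\<close> is distributed like \<open>m + G z\<close> with \<open>z\<close> a standard
  normal vector; moreover \<open>m - c = G \<nu>\<close> and \<open>G\<^sup>T A G = diag \<omega>\<close>. Hence the quadratic form at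
  \<open>m + G z\<close> equals \<open>\<Sum>\<^sub>i \<omega>\<^sub>i (z\<^sub>i + \<nu>\<^sub>i)\<^sup>2\<close>, and the summands are independent because the \<open>z\<^sub>i\<close> are.
\<close>

section \<open>Self-adjoint maps and square roots\<close>

text \<open>\<open>posdef_sqrt\<close> is a definite description, so nothing is known about it until
  a positive definite root is shown to exist and to be unique. Both facts rest on an orthonormal
  eigenbasis: the root is built on the eigenbasis of the given matrix, and uniqueness is read off an
  eigenbasis of the difference of two roots. A factor of \<Sigma> is determined only up to a
  rotation on the right; the factor \<open>P\<close> in \<open>G\<close> spends this freedom on
  diagonalising the quadratic form. The measure-theoretic obstacle is that
  \<open>gaussian_vector\<close> speaks of a density on \<open>real^'n\<close>, while independence
  of the \<open>W i\<close> speaks of a product measure on functions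
  \<open>'n \<Rightarrow> real\<close>. The two descriptions meet on the product of standard normal
  laws, linked to \<open>real^'n\<close> by \<open>vec_lambda\<close>, and the passage needs the
  change of variables for an invertible matrix. \<open>X\<close> and \<open>W\<close> live on
  unrelated probability spaces, so only laws are compared.\<close>

lemma self_adjoint_eigenvector:
  fixes f :: "'a::euclidean_space \<Rightarrow> 'a"
  assumes lin: "linear f" and adj: "\<And>x y. f x \<bullet> y = x \<bullet> f y"
    and V: "subspace V" "f ` V \<subseteq> V" "V \<noteq> {0}"
  obtains v where "v \<in> V" "norm v = 1" "f v = (v \<bullet> f v) *\<^sub>R v"
proof -
  \<comment> \<open>The eigenvector is a maximiser of the quadratic form
    \<open>x \<bullet> f x\<close> on the unit sphere of \<open>V\<close>, which exists by
    compactness.\<close>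
  have "compact (V \<inter> sphere 0 1)"
    using closed_subspace[OF V(1)] by (simp add: closed_Int_compact)
  moreover have "V \<inter> sphere 0 1 \<noteq> {}"
  proof -
    obtain x where "x \<in> V" "x \<noteq> 0"
      using V subspace_0 by blast
    then have "x /\<^sub>R norm x \<in> V \<inter> sphere 0 1"
      using V(1) by (simp add: subspace_scale)
    then show ?thesis by blast
  qed
  moreover have "continuous_on (V \<inter> sphere 0 1) (\<lambda>x. x \<bullet> f x)"
    using lin by (intro continuous_intros linear_continuous_on) (simp add: linear_conv_bounded_linear)
  ultimately obtain v where "v \<in> V \<inter> sphere 0 1" "\<forall>y\<in>V \<inter> sphere 0 1. y \<bullet> f y \<le> v \<bullet> f v"
    using continuous_attains_sup by blast
  then have v: "v \<in> V" "norm v = 1"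
    and max: "\<And>y. y \<in> V \<Longrightarrow> norm y = 1 \<Longrightarrow> y \<bullet> f y \<le> v \<bullet> f v"
    by auto
  define \<mu> where "\<mu> = v \<bullet> f v"
  have max': "x \<bullet> f x \<le> \<mu> * (x \<bullet> x)" if "x \<in> V" for x
  proof (cases "x = 0")
    case True
    then show ?thesis by simp
  next
    case False
    have "(x /\<^sub>R norm x) \<bullet> f (x /\<^sub>R norm x) \<le> \<mu>"
      unfolding \<mu>_def using False that V(1) by (intro max) (auto simp: subspace_scale)
    then have "x \<bullet> f x / (norm x)\<^sup>2 \<le> \<mu>"
      by (simp add: linear_scale[OF lin] power2_eq_square divide_inverse mult_ac)
    then show ?thesis
      using False by (simp add: dot_square_norm divide_le_eq)
  qed
  \<comment> \<open>\<open>w\<close> is the defect in the eigenvalue equation. It is itself an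
    admissible direction of variation in \<open>V\<close>, and maximality of \<open>v\<close> will
    force it to vanish.\<close>
  define w where "w = f v - \<mu> *\<^sub>R v"
  have vv: "v \<bullet> v = 1"
    using v by (simp add: dot_square_norm)
  have wV: "w \<in> V"
    unfolding w_def using V v by (auto intro!: subspace_diff subspace_scale)
  have wv: "w \<bullet> v = 0"
    by (simp add: w_def inner_diff_left vv \<mu>_def inner_commute[of "f v"])
  have wfv: "w \<bullet> f v = w \<bullet> w"
  proof -
    have "f v = w + \<mu> *\<^sub>R v" by (simp add: w_def)
    then show ?thesis by (simp add: inner_add_right wv)
  qed
  define K where "K = \<mu> * (w \<bullet> w) - w \<bullet> f w"
  \<comment> \<open>Maximality at \<open>v + t *\<^sub>R w\<close>: the constant terms cancel, the
    left side is the first-order gain in \<open>t\<close>, and \<open>K\<close> collects the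
    second-order terms.\<close>
  have ineq: "2 * t * (w \<bullet> w) \<le> t\<^sup>2 * K" for t
  proof -
    have "(v + t *\<^sub>R w) \<bullet> f (v + t *\<^sub>R w) \<le> \<mu> * ((v + t *\<^sub>R w) \<bullet> (v + t *\<^sub>R w))"
      using V v wV by (intro max') (auto intro!: subspace_add subspace_scale)
    moreover have "v \<bullet> f w = w \<bullet> w"
      using adj[of v w] wfv by (simp add: inner_commute)
    ultimately show ?thesis
      using wv
      by (simp add: linear_add[OF lin] linear_scale[OF lin] inner_add_left inner_add_right
          vv wfv \<mu>_def[symmetric] K_def power2_eq_square algebra_simps inner_commute[of v w])
  qed
  have "w \<bullet> w = 0"
  proof (rule ccontr)
    assume "w \<bullet> w \<noteq> 0"
    then have pos: "w \<bullet> w > 0" by simp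
    \<comment> \<open>Small enough that \<open>t * K\<close> is at most
      \<open>w \<bullet> w\<close>, against the bound \<open>2 * (w \<bullet> w)\<close> that
      \<open>ineq\<close> demands; the summand 1 keeps the denominator positive.\<close>
    define t where "t = (w \<bullet> w) / (\<bar>K\<bar> + 1)"
    have t: "t > 0" and tK: "t * (\<bar>K\<bar> + 1) = w \<bullet> w"
      using pos by (auto simp: t_def)
    have "t * (2 * (w \<bullet> w)) \<le> t * (t * K)"
      using ineq[of t] by (simp add: power2_eq_square algebra_simps)
    then have "2 * (w \<bullet> w) \<le> t * K"
      using t by simp
    also have "\<dots> \<le> t * (\<bar>K\<bar> + 1)"
      using t by (intro mult_left_mono) auto
    finally show False
      using tK pos by simp
  qed
  then have "f v = (v \<bullet> f v) *\<^sub>R v"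
    by (simp add: w_def \<mu>_def)
  then show thesis
    using that v by blast
qed

text \<open>Orthonormal sets of eigenvectors can be enlarged one vector at a time, because a
  self-adjoint map preserves the orthogonal complement of its eigenvectors and so has an eigenvector
  there.\<close>

lemma self_adjoint_eigenbasis:
  fixes f :: "'a::euclidean_space \<Rightarrow> 'a"
  assumes lin: "linear f" and adj: "\<And>x y. f x \<bullet> y = x \<bullet> f y"
  obtains B where "finite B" "pairwise orthogonal B" "\<And>b. b \<in> B \<Longrightarrow> norm b = 1"
    "\<And>b. b \<in> B \<Longrightarrow> f b = (b \<bullet> f b) *\<^sub>R b" "span B = UNIV"
proof -
  have ex: "\<exists>B. finite B \<and> card B = n \<and> pairwise orthogonal B \<and>
          (\<forall>b\<in>B. norm b = 1 \<and> f b = (b \<bullet> f b) *\<^sub>R b)" if "n \<le> DIM('a)" for n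
    using that
  proof (induction n)
    case 0
    then show ?case by (intro exI[of _ "{}"]) auto
  next
    case (Suc n)
    then obtain B where B: "finite B" "card B = n" "pairwise orthogonal B"
      "\<And>b. b \<in> B \<Longrightarrow> norm b = 1" "\<And>b. b \<in> B \<Longrightarrow> f b = (b \<bullet> f b) *\<^sub>R b"
      by auto
    define V where "V = {y. \<forall>x\<in>B. orthogonal x y}"
    \<comment> \<open>Fewer vectors than the dimension leave a nonzero vector orthogonal to all of
      them, so the complement \<open>V\<close> is nontrivial.\<close>
    have "dim B < DIM('a)"
      using dim_le_card'[OF B(1)] B(2) Suc.prems by simp
    then obtain x where x: "x \<noteq> 0" "\<And>y. y \<in> span B \<Longrightarrow> orthogonal x y"
      using orthogonal_to_subspace_exists by blast
    then have "x \<in> V"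
      by (auto simp: V_def orthogonal_commute span_base)
    moreover have "f ` V \<subseteq> V"
    proof -
      have "orthogonal b (f y)" if "b \<in> B" "y \<in> V" for b y
      proof -
        have "b \<bullet> f y = ((b \<bullet> f b) *\<^sub>R b) \<bullet> y"
          using adj B(5) that by metis
        then show ?thesis
          using that by (simp add: V_def orthogonal_def)
      qed
      then show ?thesis by (auto simp: V_def)
    qed
    moreover have "subspace V"
      unfolding V_def by (rule subspace_orthogonal_to_vectors)
    ultimately obtain v where v: "v \<in> V" "norm v = 1" "f v = (v \<bullet> f v) *\<^sub>R v"
      using self_adjoint_eigenvector[OF lin adj, of V] x(1) by blast
    have "v \<notin> B"
      using v by (auto simp: V_def orthogonal_self)
    moreover have "pairwise orthogonal (insert v B)"
      using B(3) v(1) by (auto simp: pairwise_insert V_def orthogonal_commute)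
    ultimately show ?case
      using B v by (intro exI[of _ "insert v B"]) auto
  qed
  obtain B where B: "finite B" "card B = DIM('a)" "pairwise orthogonal B"
    "\<And>b. b \<in> B \<Longrightarrow> norm b = 1" "\<And>b. b \<in> B \<Longrightarrow> f b = (b \<bullet> f b) *\<^sub>R b"
    using ex[OF order_refl] by metis
  have "0 \<notin> B"
    using B(4) by force
  then have "independent B"
    using B(3) by (simp add: pairwise_orthogonal_independent)
  then have "span B = UNIV"
    using card_ge_dim_independent[of B UNIV] B(2) by auto
  then show thesis
    using that B by blast
qed

section \<open>Positive definite matrices and their square roots\<close>

lemma sym_posdef_adjoint:
  assumes "sym_posdef A"
  shows "(A *v x) \<bullet> y = x \<bullet> (A *v y)"
  using assms by (simp add: sym_posdef_def dot_lmul_matrix flip: vector_transpose_matrix)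

lemma sym_posdef_det_nonzero:
  assumes "sym_posdef A"
  shows "det A \<noteq> 0"
proof -
  have "x = 0" if "A *v x = 0" for x
    using assms that by (force simp: sym_posdef_def)
  then show ?thesis
    using invertible_det_nz invertible_left_inverse matrix_left_invertible_ker by metis
qed

text \<open>Spectral calculus: on an orthonormal eigenbasis, replace each eigenvalue by its square
  root, which is real and positive by definiteness.\<close>

lemma sym_posdef_sqrt_exists:
  fixes S :: "real^'n^'n"
  assumes S: "sym_posdef S"
  obtains R where "sym_posdef R" "R ** R = S"
proof -
  obtain B where B: "finite B" "pairwise orthogonal B" "\<And>b. b \<in> B \<Longrightarrow> norm b = 1"
    "\<And>b. b \<in> B \<Longrightarrow> S *v b = (b \<bullet> (S *v b)) *\<^sub>R b" "span B = UNIV"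
    using self_adjoint_eigenbasis[of "(*v) S"] sym_posdef_adjoint[OF S] by auto
  define r where "r b = sqrt (b \<bullet> (S *v b))" for b
  have pos: "b \<bullet> (S *v b) > 0" if "b \<in> B" for b
  proof -
    have "b \<noteq> 0" using B(3)[OF that] by auto
    then show ?thesis using S by (simp add: sym_posdef_def)
  qed
  have r: "r b > 0" if "b \<in> B" for b
    using pos[OF that] by (simp add: r_def)
  define f where "f x = (\<Sum>b\<in>B. (r b * (b \<bullet> x)) *\<^sub>R b)" for x
  have lin: "linear f"
    by (rule linearI)
       (auto simp: f_def inner_add_right algebra_simps sum.distrib scaleR_sum_right intro!: sum.cong)
  have fb: "f b = r b *\<^sub>R b" if "b \<in> B" for b
  proof -
    have "f b = (\<Sum>b'\<in>B. if b' = b then r b *\<^sub>R b else 0)"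
      unfolding f_def using that B(2,3)
      by (intro sum.cong) (auto simp: pairwise_def orthogonal_def dot_square_norm)
    then show ?thesis
      using B(1) that by simp
  qed
  \<comment> \<open>This form is visibly symmetric in \<open>x\<close> and \<open>y\<close>, and for
    \<open>x = y\<close> it is a sum of squares with positive weights; it yields both halves of
    \<open>sym_posdef R\<close>.\<close>
  have inner_f: "x \<bullet> f y = (\<Sum>b\<in>B. r b * (b \<bullet> x) * (b \<bullet> y))" for x y
    by (simp add: f_def inner_sum_right mult_ac inner_commute[of x])
  define R where "R = matrix f"
  have R: "R *v x = f x" for x
    using lin by (simp add: R_def matrix_works)
  have "transpose R = R"
  proof -
    have "transpose R *v x = R *v x" for x
    proof (rule vector_eq_ldot[THEN iffD1], rule allI)
      fix y
      have "y \<bullet> (transpose R *v x) = (R *v y) \<bullet> x"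
        by (metis dot_lmul_matrix inner_commute transpose_matrix_vector vector_transpose_matrix)
      also have "\<dots> = y \<bullet> (R *v x)"
        by (simp add: R inner_f inner_commute[of _ x] mult_ac)
      finally show "y \<bullet> (transpose R *v x) = y \<bullet> (R *v x)" .
    qed
    then show ?thesis
      by (simp add: matrix_eq)
  qed
  moreover have "0 < x \<bullet> (R *v x)" if "x \<noteq> 0" for x
  proof -
    have "\<exists>b\<in>B. b \<bullet> x \<noteq> 0"
    proof (rule ccontr)
      assume "\<not> (\<exists>b\<in>B. b \<bullet> x \<noteq> 0)"
      then have "orthogonal x y" if "y \<in> span B" for y
        using that by (intro orthogonal_to_span[of y B]) (auto simp: orthogonal_def inner_commute)
      then show False
        using B(5) that orthogonal_self by blast
    qed
    then show ?thesis
      unfolding R inner_f using B(1) r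
      by (auto intro!: sum_pos2 simp: mult.assoc less_imp_le power2_eq_square zero_less_mult_iff
          linorder_neq_iff)
  qed
  moreover have "R ** R = S"
  proof -
    have "(R ** R) *v x = S *v x" for x
    proof (rule linear_eq_on[of "(*v) (R ** R)" "(*v) S" _ B])
      fix b assume b: "b \<in> B"
      have "(R ** R) *v b = (r b * r b) *\<^sub>R b"
        using b by (simp add: R fb linear_scale[OF lin] flip: matrix_vector_mul_assoc)
      also have "\<dots> = (b \<bullet> (S *v b)) *\<^sub>R b"
        using pos[OF b] by (simp add: r_def)
      finally show "(R ** R) *v b = S *v b"
        using B(4)[OF b] by simp
    qed (use B(5) in auto)
    then show ?thesis
      by (simp add: matrix_eq)
  qed
  ultimately show thesis
    using that[of R] by (simp add: sym_posdef_def)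
qed

text \<open>If \<open>D = R - T\<close> with \<open>R\<^sup>2 = T\<^sup>2\<close>, then \<open>R D + D T = 0\<close>; pairing this with a unit eigenvector
  \<open>b\<close> of \<open>D\<close> for the eigenvalue \<open>\<lambda>\<close> gives \<open>\<lambda> (b \<bullet> R b + b \<bullet> T b) = 0\<close>, hence \<open>\<lambda> = 0\<close>.\<close>
lemma sym_posdef_sqrt_unique:
  fixes R T :: "real^'n^'n"
  assumes R: "sym_posdef R" and T: "sym_posdef T" and eq: "R ** R = T ** T"
  shows "R = T"
proof -
  define f where "f x = R *v x - T *v x" for x
  have lin: "linear f"
    unfolding f_def by (intro linear_compose_sub) auto
  have adj: "f x \<bullet> y = x \<bullet> f y" for x y
    by (simp add: f_def inner_diff_left inner_diff_right sym_posdef_adjoint[OF R]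
        sym_posdef_adjoint[OF T])
  obtain B where B: "finite B" "pairwise orthogonal B" "\<And>b. b \<in> B \<Longrightarrow> norm b = 1"
    "\<And>b. b \<in> B \<Longrightarrow> f b = (b \<bullet> f b) *\<^sub>R b" "span B = UNIV"
    using self_adjoint_eigenbasis[OF lin adj] by blast
  have "f x = 0" for x
  proof (rule linear_eq_on[OF lin linear_zero, of _ B])
    fix b assume b: "b \<in> B"
    let ?l = "b \<bullet> f b"
    have "R *v (f b) + f (T *v b) = (R ** R) *v b - (T ** T) *v b"
      by (simp add: f_def matrix_vector_mult_diff_distrib flip: matrix_vector_mul_assoc)
    then have "b \<bullet> (R *v (f b)) + b \<bullet> f (T *v b) = 0"
      by (simp add: eq flip: inner_add_right)
    moreover have "b \<bullet> (R *v (f b)) = ?l * (b \<bullet> (R *v b))"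
      by (subst B(4)[OF b]) (simp add: matrix_vector_mult_scaleR)
    moreover have "b \<bullet> f (T *v b) = ?l * (b \<bullet> (T *v b))"
      by (metis B(4)[OF b] adj inner_scaleR_left)
    ultimately have "?l * (b \<bullet> (R *v b) + b \<bullet> (T *v b)) = 0"
      by (simp add: algebra_simps)
    moreover have "b \<bullet> (R *v b) + b \<bullet> (T *v b) > 0"
      using R T B(3)[OF b] unfolding sym_posdef_def
      by (metis add_pos_pos norm_zero zero_neq_one)
    ultimately have "?l = 0" by simp
    then show "f b = 0"
      using B(4)[OF b] by simp
  qed (use B(5) in auto)
  then show ?thesis
    by (simp add: f_def matrix_eq)
qed

text \<open>Existence and uniqueness discharge the \<open>THE\<close>; from here on these two
  properties are all that is used of the root.\<close>

lemma posdef_sqrt: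
  assumes "sym_posdef S"
  shows "sym_posdef (posdef_sqrt S)" "posdef_sqrt S ** posdef_sqrt S = S"
proof -
  have "\<exists>!R. sym_posdef R \<and> R ** R = S"
    using sym_posdef_sqrt_exists[OF assms] sym_posdef_sqrt_unique by metis
  from theI'[OF this]
  show "sym_posdef (posdef_sqrt S)" "posdef_sqrt S ** posdef_sqrt S = S"
    by (auto simp: posdef_sqrt_def)
qed

lemma matrix_inv_mult:
  fixes A :: "real^'n^'n"
  assumes "det A \<noteq> 0"
  shows "A ** matrix_inv A = mat 1" "matrix_inv A ** A = mat 1"
proof -
  have "\<exists>B. A ** B = mat 1 \<and> B ** A = mat 1"
    using assms unfolding invertible_det_nz[symmetric] invertible_def .
  from someI_ex[OF this]
  show "A ** matrix_inv A = mat 1" "matrix_inv A ** A = mat 1"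
    unfolding matrix_inv_def by auto
qed

section \<open>Gaussian measures on Euclidean space\<close>

lemma prod_Basis_vec:
  "(\<Prod>b\<in>(Basis :: (real^'n) set). f b) = (\<Prod>i\<in>UNIV. f (axis i 1))"
proof -
  have "(Basis :: (real^'n) set) = (\<lambda>i. axis i 1) ` UNIV"
    by (auto simp: Basis_vec_def)
  then show ?thesis
    by (subst \<open>Basis = _\<close>, subst prod.reindex) (auto simp: inj_on_def axis_eq_axis)
qed

text \<open>The factors are left general because the lemma is applied to Lebesgue as well as to
  standard normal factors.\<close>

lemma measurable_vec_lambda:
  fixes M :: "'n::finite \<Rightarrow> real measure"
  assumes "\<And>i. sets (M i) = sets borel"
  shows "vec_lambda \<in> Pi\<^sub>M UNIV M \<rightarrow>\<^sub>M (borel :: (real^'n) measure)"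
proof (rule borel_measurable_euclidean_space[THEN iffD2], rule ballI)
  fix b :: "real^'n" assume "b \<in> Basis"
  then obtain i where "b = axis i 1"
    by (auto simp: Basis_vec_def)
  moreover have "(\<lambda>x. x i) \<in> Pi\<^sub>M UNIV M \<rightarrow>\<^sub>M borel"
    using measurable_component_singleton[of i UNIV M] assms by (simp cong: measurable_cong_sets)
  ultimately show "(\<lambda>x. vec_lambda x \<bullet> b) \<in> borel_measurable (Pi\<^sub>M UNIV M)"
    by (simp add: inner_axis)
qed

text \<open>Lebesgue measure is characterised by the volumes of open boxes, and a box corresponds to
  a rectangle of intervals. This makes Fubini in a single coordinate available on
  \<open>real^'n\<close>.\<close>

lemma lborel_vec_eq_distr_PiM:
  "(lborel :: (real^'n) measure) = distr (\<Pi>\<^sub>M i\<in>UNIV. lborel) borel vec_lambda"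
proof (rule lborel_eqI)
  interpret product_sigma_finite "\<lambda>i::'n. lborel :: real measure" ..
  have meas: "vec_lambda \<in> (\<Pi>\<^sub>M i\<in>(UNIV::'n set). lborel :: real measure) \<rightarrow>\<^sub>M (borel :: (real^'n) measure)"
    by (rule measurable_vec_lambda) simp
  fix l u :: "real^'n"
  assume le: "\<And>b. b \<in> Basis \<Longrightarrow> l \<bullet> b \<le> u \<bullet> b"
  then have le': "l $ i \<le> u $ i" for i
    using le[of "axis i 1"] by (simp add: inner_axis axis_in_Basis_iff)
  have "emeasure (distr (\<Pi>\<^sub>M i\<in>UNIV. lborel) borel vec_lambda) (box l u)
      = emeasure (\<Pi>\<^sub>M i\<in>UNIV. lborel) (Pi\<^sub>E UNIV (\<lambda>i. {l $ i <..< u $ i}))"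
    using meas by (subst emeasure_distr)
      (auto simp: mem_box_cart space_PiM PiE_iff intro!: arg_cong2[where f = emeasure])
  also have "\<dots> = (\<Prod>i\<in>UNIV. ennreal (u $ i - l $ i))"
    using le' by (subst emeasure_PiM) auto
  also have "\<dots> = ennreal (\<Prod>i\<in>UNIV. u $ i - l $ i)"
    using le' by (simp add: prod_ennreal)
  also have "(\<Prod>i\<in>UNIV. u $ i - l $ i) = (\<Prod>b\<in>Basis. (u - l) \<bullet> b)"
    by (simp add: prod_Basis_vec inner_axis)
  finally show "emeasure (distr (\<Pi>\<^sub>M i\<in>UNIV. lborel) borel vec_lambda) (box l u)
      = (\<Prod>b\<in>Basis. (u - l) \<bullet> b)" .
qed simp

text \<open>With all coordinates but \<open>m\<close> frozen, the shear is a translation of the real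
  line by the constant \<open>x $ n\<close>, and translations preserve Lebesgue measure.\<close>

lemma distr_lborel_shear:
  fixes m n :: "'n::finite"
  assumes "m \<noteq> n"
  shows "distr lborel borel (\<lambda>x::real^'n. \<chi> i. if i = m then x $ m + x $ n else x $ i) = lborel"
    (is "distr _ _ ?T = _")
proof (rule measure_eqI)
  interpret product_sigma_finite "\<lambda>i::'n. lborel :: real measure" ..
  have meas: "vec_lambda \<in> (\<Pi>\<^sub>M i\<in>(UNIV::'n set). lborel :: real measure) \<rightarrow>\<^sub>M (borel :: (real^'n) measure)"
    by (rule measurable_vec_lambda) simp
  have "continuous_on UNIV (\<lambda>x::real^'n. if i = m then x $ m + x $ n else x $ i)" for i
    by (cases "i = m") (auto intro!: continuous_intros)
  then have T[measurable]: "?T \<in> borel_measurable borel"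
    by (intro borel_measurable_continuous_onI continuous_on_vec_lambda)
  \<comment> \<open>Coordinate \<open>m\<close> is integrated innermost. The map \<open>h\<close> is
    general so that the formula serves both for the shear and for the identity.\<close>
  have Fubini: "emeasure (distr lborel borel h) A
      = (\<integral>\<^sup>+f. \<integral>\<^sup>+y. indicator A (h (vec_lambda (f(m := y)))) \<partial>lborel \<partial>(\<Pi>\<^sub>M i\<in>UNIV - {m}. lborel))"
    if [measurable]: "h \<in> borel_measurable borel" "A \<in> sets borel" for h :: "real^'n \<Rightarrow> real^'n" and A
  proof -
    have "emeasure (distr lborel borel h) A = (\<integral>\<^sup>+x. indicator A (h x) \<partial>lborel)"
      using that by (simp add: nn_integral_distr flip: nn_integral_indicator)
    also have "\<dots> = (\<integral>\<^sup>+f. indicator A (h (vec_lambda f)) \<partial>(\<Pi>\<^sub>M i\<in>UNIV. lborel))"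
      by (subst lborel_vec_eq_distr_PiM, subst nn_integral_distr[OF meas]) simp_all
    also have "(UNIV :: 'n set) = insert m (UNIV - {m})"
      by auto
    also have "(\<integral>\<^sup>+f. indicator A (h (vec_lambda f)) \<partial>(\<Pi>\<^sub>M i\<in>insert m (UNIV - {m}). lborel))
        = (\<integral>\<^sup>+f. \<integral>\<^sup>+y. indicator A (h (vec_lambda (f(m := y)))) \<partial>lborel \<partial>(\<Pi>\<^sub>M i\<in>UNIV - {m}. lborel))"
    proof (rule product_nn_integral_insert)
      have "(\<lambda>f. h (vec_lambda f)) \<in> (\<Pi>\<^sub>M i\<in>UNIV. lborel) \<rightarrow>\<^sub>M borel"
        by (rule measurable_compose[OF meas that(1)])
      then show "(\<lambda>f. indicator A (h (vec_lambda f)) :: ennreal)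
          \<in> borel_measurable (\<Pi>\<^sub>M i\<in>insert m (UNIV - {m}). lborel)"
        using that(2) by (simp add: insert_UNIV)
    qed auto
    finally show ?thesis .
  qed
  fix A :: "(real^'n) set" assume "A \<in> sets (distr lborel borel ?T)"
  then have A[measurable]: "A \<in> sets borel" by simp
  have shift: "(\<integral>\<^sup>+y. indicator A (?T (vec_lambda (f(m := y)))) \<partial>lborel)
      = (\<integral>\<^sup>+y. indicator A (vec_lambda (f(m := y))) \<partial>lborel)" for f
  proof -
    have "continuous_on UNIV (\<lambda>y. (f(m := y)) i)" for i
      by (cases "i = m") (auto intro: continuous_intros)
    then have [measurable]: "(\<lambda>y. vec_lambda (f(m := y))) \<in> borel_measurable borel"
      using continuous_on_vec_lambda[of UNIV "\<lambda>i y. (f(m := y)) i"]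
      by (intro borel_measurable_continuous_onI) (simp add: fun_upd_def)
    have "?T (vec_lambda (f(m := y))) = vec_lambda (f(m := f n + y))" for y
      using assms by (auto simp: vec_eq_iff)
    then have "(\<integral>\<^sup>+y. indicator A (?T (vec_lambda (f(m := y)))) \<partial>lborel)
        = (\<integral>\<^sup>+y. indicator A (vec_lambda (f(m := y))) \<partial>distr lborel borel ((+) (f n)))"
      by (subst nn_integral_distr) simp_all
    then show ?thesis
      by (simp add: lborel_distr_plus)
  qed
  have "emeasure (distr lborel borel ?T) A = emeasure (distr lborel borel (\<lambda>x. x)) A"
    by (simp only: Fubini[OF T A] Fubini[OF measurable_ident_sets[OF refl] A] shift)
  then show "emeasure (distr lborel borel ?T) A = emeasure lborel A"
    by (simp add: distr_id2)
qed simp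

lemma distr_lborel_permute:
  assumes p: "p permutes (UNIV :: 'n::finite set)"
  shows "distr lborel borel (\<lambda>x::real^'n. \<chi> i. x $ p i) = lborel"
proof (rule lborel_eqI[symmetric])
  have [measurable]: "(\<lambda>x::real^'n. \<chi> i. x $ p i) \<in> borel_measurable borel"
    by (intro borel_measurable_continuous_onI continuous_on_vec_lambda continuous_intros)
  have q: "inv p permutes UNIV"
    using p by (rule permutes_inv)
  fix l u :: "real^'n"
  assume le: "\<And>b. b \<in> Basis \<Longrightarrow> l \<bullet> b \<le> u \<bullet> b"
  then have le': "l $ i \<le> u $ i" for i
    using le[of "axis i 1"] by (simp add: inner_axis axis_in_Basis_iff)
  \<comment> \<open>The constraint on \<open>x $ p i\<close> comes from side \<open>i\<close> of the
    box, so side \<open>j\<close> of the preimage is side \<open>inv p j\<close> of the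
    original.\<close>
  let ?l = "\<chi> i. l $ inv p i" and ?u = "\<chi> i. u $ inv p i"
  have "(\<lambda>x::real^'n. \<chi> i. x $ p i) -` box l u = box ?l ?u"
    using permutes_inverses[OF p] by (auto simp: mem_box_cart) metis+
  then have "emeasure (distr lborel borel (\<lambda>x::real^'n. \<chi> i. x $ p i)) (box l u) = emeasure lborel (box ?l ?u)"
    by (simp add: emeasure_distr)
  also have "\<dots> = (\<Prod>b\<in>Basis. (?u - ?l) \<bullet> b)"
    using le' by (intro emeasure_lborel_box) (auto simp: Basis_vec_def inner_axis)
  also have "(\<Prod>b\<in>Basis. (?u - ?l) \<bullet> b) = (\<Prod>i\<in>UNIV. (u - l) $ inv p i)"
    by (simp add: prod_Basis_vec inner_axis)
  also have "\<dots> = (\<Prod>b\<in>Basis. (u - l) \<bullet> b)"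
    unfolding prod_Basis_vec using prod.permute[OF q, of "\<lambda>i. (u - l) $ i"]
    by (simp add: o_def inner_axis)
  finally show "emeasure (distr lborel borel (\<lambda>x::real^'n. \<chi> i. x $ p i)) (box l u)
      = (\<Prod>b\<in>Basis. (u - l) \<bullet> b)" .
qed simp

lemma distr_lborel_stretch:
  fixes c :: "'n::finite \<Rightarrow> real"
  assumes c: "\<And>i. c i \<noteq> 0"
  shows "distr lborel borel (\<lambda>x::real^'n. \<chi> i. c i * x $ i)
    = density lborel (\<lambda>_. ennreal (1 / \<bar>\<Prod>i\<in>UNIV. c i\<bar>))"
proof -
  \<comment> \<open>The affine change of variables takes scaling factors indexed by basis vectors;
    \<open>d\<close> carries \<open>c i\<close> over to \<open>axis i 1\<close>.\<close>
  define d where "d b = (\<Sum>i\<in>UNIV. c i * b $ i)" for b :: "real^'n"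
  have d: "d (axis i 1) = c i" for i
    by (simp add: d_def axis_def if_distrib[where f = "\<lambda>x. _ * x"] cong: if_cong)
  have T: "(\<Sum>b\<in>Basis. (d b * (x \<bullet> b)) *\<^sub>R b) = (\<chi> i. c i * x $ i)" for x :: "real^'n"
  proof (rule euclidean_eqI)
    fix b :: "real^'n" assume b: "b \<in> Basis"
    then obtain i where "b = axis i 1"
      by (auto simp: Basis_vec_def)
    moreover have "(\<Sum>b\<in>Basis. (d b * (x \<bullet> b)) *\<^sub>R b) \<bullet> b = d b * (x \<bullet> b)"
      using b by simp
    ultimately show "(\<Sum>b\<in>Basis. (d b * (x \<bullet> b)) *\<^sub>R b) \<bullet> b = (\<chi> i. c i * x $ i) \<bullet> b"
      by (simp add: d inner_axis)
  qed
  have "d b \<noteq> 0" if "b \<in> Basis" for b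
    using that c by (auto simp: Basis_vec_def d)
  from lborel_affine_euclidean[of d 0, OF this]
  have lb: "lborel = density (distr lborel borel (\<lambda>x. \<chi> i. c i * x $ i)) (\<lambda>_. ennreal \<bar>\<Prod>i\<in>UNIV. c i\<bar>)"
    by (simp add: T prod_Basis_vec d abs_prod)
  have "\<bar>\<Prod>i\<in>UNIV. c i\<bar> \<noteq> 0"
    using c by simp
  then show ?thesis
    by (subst (2) lb, subst density_density_eq) (simp_all add: density_1 flip: ennreal_mult)
qed

text \<open>The library lemma \<open>measure_linear_image\<close> is restricted to well-ordered index types, so the
  change of variables is done here for an arbitrary finite index type.\<close>
lemma distr_lborel_matrix:
  fixes G :: "real^'n^'n"
  shows "det G \<noteq> 0 \<Longrightarrow> distr lborel borel ((*v) G) = density lborel (\<lambda>_. ennreal (1 / \<bar>det G\<bar>))"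
proof (induction G rule: induct_matrix_elementary_alt)
  case (1 A B)
  have meas: "(*v) C \<in> borel_measurable borel" for C :: "real^'n^'n"
    by (intro borel_measurable_continuous_onI continuous_intros)
  have "(*v) (A ** B) = (*v) A \<circ> (*v) B"
    by (auto simp: matrix_vector_mul_assoc)
  then have "distr lborel borel ((*v) (A ** B)) = distr (distr lborel borel ((*v) B)) borel ((*v) A)"
    using meas by (simp add: distr_distr)
  also have "\<dots> = distr (density lborel (\<lambda>_. ennreal (1 / \<bar>det B\<bar>))) borel ((*v) A)"
    using 1 by (simp add: det_mul)
  also have "\<dots> = density (distr lborel borel ((*v) A)) (\<lambda>_. ennreal (1 / \<bar>det B\<bar>))"
    using meas[of A] by (subst density_distr) auto
  also have "\<dots> = density lborel (\<lambda>_. ennreal (1 / \<bar>det (A ** B)\<bar>))"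
    using 1 by (simp add: det_mul density_density_eq abs_mult flip: ennreal_mult)
  finally show ?case .
next
  \<comment> \<open>A zero row contradicts the premise that the determinant is nonzero.\<close>
  case (2 A i)
  then show ?case using det_zero_row(2) by blast
next
  case (3 A)
  then have "det A = (\<Prod>i\<in>UNIV. A $ i $ i)"
    by (intro det_diagonal) auto
  moreover have "(*v) A = (\<lambda>x. \<chi> i. A $ i $ i * x $ i)"
  proof
    fix x
    have "(\<Sum>j\<in>UNIV. A $ i $ j * x $ j) = (\<Sum>j\<in>UNIV. if j = i then A $ i $ i * x $ i else 0)" for i
      using 3 by (intro sum.cong) auto
    then show "A *v x = (\<chi> i. A $ i $ i * x $ i)"
      by (simp add: matrix_vector_mult_def vec_eq_iff)
  qed
  ultimately show ?case
    using 3 distr_lborel_stretch[of "\<lambda>i. A $ i $ i"] by simp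
next
  case (4 m n)
  let ?p = "Transposition.transpose m n" and ?S = "(\<chi> i j. mat 1 $ i $ Transposition.transpose m n j) :: real^'n^'n"
  have S: "?S *v x = (\<chi> i. x $ ?p i)" for x
  proof -
    have "(\<Sum>j\<in>UNIV. ?S $ i $ j * x $ j) = (\<Sum>j\<in>UNIV. if j = ?p i then x $ j else 0)" for i
      by (intro sum.cong) (auto simp: mat_def)
    then show ?thesis
      by (simp add: matrix_vector_mult_def vec_eq_iff)
  qed
  \<comment> \<open>A swap is an involution, so its determinant squares to 1; only the absolute
    value matters, and no sign has to be computed.\<close>
  have "?S ** ?S = mat 1"
    by (simp add: matrix_eq S vec_eq_iff flip: matrix_vector_mul_assoc)
  then have "det ?S * det ?S = 1"
    by (metis det_I det_mul)
  then have "\<bar>det ?S\<bar> = 1"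
    by (auto simp: square_eq_1_iff)
  moreover have "(*v) ?S = (\<lambda>x. \<chi> i. x $ ?p i)"
    using S by blast
  ultimately show ?case
    using distr_lborel_permute[OF permutes_swap_id[of m UNIV n]] by (simp add: density_1)
next
  case (5 m n)
  let ?S = "(\<chi> i j. of_bool (i = m \<and> j = n \<or> i = j)) :: real^'n^'n"
  \<comment> \<open>The shear matrix is the identity with row \<open>n\<close> added to row
    \<open>m\<close>, an operation that preserves the determinant.\<close>
  have "?S = (\<chi> k. if k = m then row m (mat 1) + 1 *s row n (mat 1) else row k (mat 1))"
    using 5 by (auto simp: vec_eq_iff row_def mat_def)
  then have "det ?S = 1"
    using det_row_operation[OF 5(1), of "mat 1 :: real^'n^'n" 1] by (simp only: det_I)
  moreover have "(*v) ?S = (\<lambda>x. \<chi> i. if i = m then x $ m + x $ n else x $ i)"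
  proof
    fix x
    have "(\<Sum>j\<in>UNIV. ?S $ i $ j * x $ j)
        = (\<Sum>j\<in>UNIV. (if j = i then x $ j else 0) + (if j = n then if i = m then x $ j else 0 else 0))" for i
      using 5(1) by (intro sum.cong) auto
    then show "?S *v x = (\<chi> i. if i = m then x $ m + x $ n else x $ i)"
      by (simp add: matrix_vector_mult_def vec_eq_iff sum.distrib)
  qed
  ultimately show ?case
    using distr_lborel_shear[OF 5(1)] by (simp add: density_1)
qed

text \<open>Lebesgue measure is written as a weighted image of itself, so that any density against
  \<open>lborel\<close> can be pulled back along the affine map.\<close>

lemma lborel_affine_matrix:
  fixes G :: "real^'n^'n"
  assumes det: "det G \<noteq> 0"
  shows "lborel = density (distr lborel borel (\<lambda>x. m + G *v x)) (\<lambda>_. ennreal \<bar>det G\<bar>)"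
proof -
  have "(*v) G \<in> borel_measurable borel"
    by (intro borel_measurable_continuous_onI continuous_intros)
  then have "distr lborel borel (\<lambda>x. m + G *v x) = distr (distr lborel borel ((*v) G)) borel ((+) m)"
    by (simp add: distr_distr o_def)
  also have "\<dots> = density (distr lborel borel ((+) m)) (\<lambda>_. ennreal (1 / \<bar>det G\<bar>))"
    using distr_lborel_matrix[OF det] by (simp add: density_distr)
  also have "\<dots> = density lborel (\<lambda>_. ennreal (1 / \<bar>det G\<bar>))"
    by (simp add: lborel_distr_plus)
  finally show ?thesis
    using det by (simp add: density_density_eq density_1 flip: ennreal_mult)
qed

section \<open>Densities and images of finite product measures\<close>

lemma PiM_density:
  fixes f :: "'i \<Rightarrow> 'b \<Rightarrow> ennreal"
  assumes "finite I" and "product_sigma_finite M"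
    and "product_sigma_finite (\<lambda>i. density (M i) (f i))"
    and f[measurable]: "\<And>i. i \<in> I \<Longrightarrow> f i \<in> borel_measurable (M i)"
  shows "density (Pi\<^sub>M I M) (\<lambda>x. \<Prod>i\<in>I. f i (x i)) = (\<Pi>\<^sub>M i\<in>I. density (M i) (f i))"
proof (rule product_sigma_finite.PiM_eqI[OF assms(3,1)])
  show "sets (density (Pi\<^sub>M I M) (\<lambda>x. \<Prod>i\<in>I. f i (x i))) = sets (\<Pi>\<^sub>M i\<in>I. density (M i) (f i))"
    by (simp cong: sets_PiM_cong)
next
  fix A assume "\<And>i. i \<in> I \<Longrightarrow> A i \<in> sets (density (M i) (f i))"
  then have A[measurable]: "A i \<in> sets (M i)" if "i \<in> I" for i
    using that by simp
  have meas: "(\<lambda>x. \<Prod>i\<in>I. f i (x i)) \<in> borel_measurable (Pi\<^sub>M I M)"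
    by (intro borel_measurable_prod_ennreal measurable_compose[OF measurable_component_singleton]) auto
  \<comment> \<open>The indicator of a rectangle is the product of the indicators of its sides, so
    the integrand splits into one factor per coordinate.\<close>
  have ind: "(\<Prod>i\<in>I. f i (x i)) * indicator (Pi\<^sub>E I A) x = (\<Prod>i\<in>I. f i (x i) * indicator (A i) (x i))"
    if "x \<in> space (Pi\<^sub>M I M)" for x
  proof (cases "\<forall>i\<in>I. x i \<in> A i")
    case True
    then have "x \<in> Pi\<^sub>E I A"
      using that by (auto simp: space_PiM PiE_def)
    then show ?thesis using True by (auto intro!: prod.cong)
  next
    case False
    then show ?thesis
      using \<open>finite I\<close> by (auto simp: prod_zero_iff PiE_def Pi_def indicator_def)
  qed
  have "emeasure (density (Pi\<^sub>M I M) (\<lambda>x. \<Prod>i\<in>I. f i (x i))) (Pi\<^sub>E I A)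
      = (\<integral>\<^sup>+x. (\<Prod>i\<in>I. f i (x i) * indicator (A i) (x i)) \<partial>Pi\<^sub>M I M)"
    using meas A \<open>finite I\<close>
    by (subst emeasure_density) (auto intro!: sets_PiM_I_finite nn_integral_cong ind)
  also have "\<dots> = (\<Prod>i\<in>I. \<integral>\<^sup>+x. f i x * indicator (A i) x \<partial>M i)"
    by (rule product_sigma_finite.product_nn_integral_prod[OF assms(2,1)]) measurable
  also have "\<dots> = (\<Prod>i\<in>I. emeasure (density (M i) (f i)) (A i))"
    by (intro prod.cong refl) (simp add: emeasure_density A)
  finally show "emeasure (density (Pi\<^sub>M I M) (\<lambda>x. \<Prod>i\<in>I. f i (x i))) (Pi\<^sub>E I A)
      = (\<Prod>i\<in>I. emeasure (density (M i) (f i)) (A i))" .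
qed

text \<open>The preimage of a rectangle under a coordinatewise map is again a rectangle, and values
  on rectangles determine a finite product measure.\<close>

lemma PiM_distr:
  assumes "finite I" and "\<And>i. i \<in> I \<Longrightarrow> f i \<in> M i \<rightarrow>\<^sub>M M' i"
    and "product_sigma_finite M" and "product_sigma_finite (\<lambda>i. distr (M i) (M' i) (f i))"
  shows "(\<lambda>x. \<lambda>i\<in>I. f i (x i)) \<in> Pi\<^sub>M I M \<rightarrow>\<^sub>M Pi\<^sub>M I M'" (is "?F \<in> _")
    and "distr (Pi\<^sub>M I M) (Pi\<^sub>M I M') (\<lambda>x. \<lambda>i\<in>I. f i (x i)) = (\<Pi>\<^sub>M i\<in>I. distr (M i) (M' i) (f i))"
proof -
  show F: "?F \<in> Pi\<^sub>M I M \<rightarrow>\<^sub>M Pi\<^sub>M I M'"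
    by (intro measurable_restrict measurable_compose[OF measurable_component_singleton] assms(2))
  show "distr (Pi\<^sub>M I M) (Pi\<^sub>M I M') ?F = (\<Pi>\<^sub>M i\<in>I. distr (M i) (M' i) (f i))"
  proof (rule product_sigma_finite.PiM_eqI[OF assms(4,1)])
    show "sets (distr (Pi\<^sub>M I M) (Pi\<^sub>M I M') ?F) = sets (\<Pi>\<^sub>M i\<in>I. distr (M i) (M' i) (f i))"
      by (simp cong: sets_PiM_cong)
  next
    fix A assume "\<And>i. i \<in> I \<Longrightarrow> A i \<in> sets (distr (M i) (M' i) (f i))"
    then have A: "A i \<in> sets (M' i)" if "i \<in> I" for i
      using that by simp
    have "?F -` Pi\<^sub>E I A \<inter> space (Pi\<^sub>M I M) = (\<Pi>\<^sub>E i\<in>I. f i -` A i \<inter> space (M i))"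
      by (auto simp: space_PiM PiE_iff)
    then have "emeasure (distr (Pi\<^sub>M I M) (Pi\<^sub>M I M') ?F) (Pi\<^sub>E I A)
        = emeasure (Pi\<^sub>M I M) (\<Pi>\<^sub>E i\<in>I. f i -` A i \<inter> space (M i))"
      using F A assms(1) by (simp add: emeasure_distr sets_PiM_I_finite)
    also have "\<dots> = (\<Prod>i\<in>I. emeasure (M i) (f i -` A i \<inter> space (M i)))"
      using A assms by (intro product_sigma_finite.emeasure_PiM) (auto intro: measurable_sets)
    also have "\<dots> = (\<Prod>i\<in>I. emeasure (distr (M i) (M' i) (f i)) (A i))"
      using A assms(2) by (intro prod.cong refl) (simp add: emeasure_distr)
    finally show "emeasure (distr (Pi\<^sub>M I M) (Pi\<^sub>M I M') ?F) (Pi\<^sub>E I A)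
        = (\<Prod>i\<in>I. emeasure (distr (M i) (M' i) (f i)) (A i))" .
  qed
qed

section \<open>Standard normal vectors and their affine images\<close>

lemma distr_std_normal_vec:
  "distr (\<Pi>\<^sub>M i\<in>(UNIV::'n set). std_normal_distribution) borel vec_lambda
   = density (lborel :: (real^'n) measure) (\<lambda>z. \<Prod>i\<in>UNIV. ennreal (std_normal_density (z $ i)))"
proof -
  have psf: "product_sigma_finite (\<lambda>i::'n. lborel :: real measure)" ..
  have psf': "product_sigma_finite (\<lambda>i::'n. std_normal_distribution)"
    by (intro product_sigma_finite.intro prob_space_imp_sigma_finite prob_space_normal_density) simp
  have meas: "vec_lambda \<in> (\<Pi>\<^sub>M i\<in>(UNIV::'n set). lborel :: real measure) \<rightarrow>\<^sub>M (borel :: (real^'n) measure)"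
    by (rule measurable_vec_lambda) simp
  have "density (lborel :: (real^'n) measure) (\<lambda>z. \<Prod>i\<in>UNIV. ennreal (std_normal_density (z $ i)))
      = distr (density (\<Pi>\<^sub>M i\<in>UNIV. lborel) (\<lambda>x. \<Prod>i\<in>UNIV. ennreal (std_normal_density (x i))))
          borel vec_lambda"
    by (subst lborel_vec_eq_distr_PiM, subst density_distr[OF _ meas]) (simp_all)
  also have "density (\<Pi>\<^sub>M i\<in>(UNIV::'n set). lborel) (\<lambda>x. \<Prod>i\<in>UNIV. ennreal (std_normal_density (x i)))
      = (\<Pi>\<^sub>M i\<in>UNIV. std_normal_distribution)"
    by (rule PiM_density[OF finite psf psf']) simp
  finally show ?thesis by simp
qed

lemma prod_std_normal_density:
  fixes z :: "real^'n"
  shows "(\<Prod>i\<in>UNIV. std_normal_density (z $ i)) = exp (- (z \<bullet> z) / 2) / sqrt ((2 * pi) ^ CARD('n))"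
proof -
  have "(\<Prod>i\<in>UNIV. std_normal_density (z $ i))
      = (\<Prod>i\<in>UNIV. exp (- (z $ i)\<^sup>2 / 2)) / sqrt (2 * pi) ^ CARD('n)"
    by (simp add: std_normal_density_def prod_dividef)
  also have "(\<Prod>i\<in>UNIV. exp (- (z $ i)\<^sup>2 / 2)) = exp (- (z \<bullet> z) / 2)"
    by (simp add: exp_sum[symmetric] inner_vec_def power2_eq_square sum_negf sum_divide_distrib)
  finally show ?thesis
    by (simp only: real_sqrt_power)
qed

text \<open>Substituting \<open>x = m + G *v z\<close> turns the exponent into
  \<open>z \<bullet> z\<close>, while the Jacobian cancels the determinant in the normalisation. Any
  invertible factor \<open>G\<close> of \<open>S\<close> works, which leaves room for the rotated
  root \<open>R ** P\<close>.\<close>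

lemma density_mvn_eq_distr:
  fixes G S :: "real^'n^'n"
  assumes det: "det G \<noteq> 0" and S: "S = G ** transpose G"
  shows "density lborel (\<lambda>x. ennreal (mvn_density m S x))
    = distr (\<Pi>\<^sub>M i\<in>UNIV. std_normal_distribution) borel (\<lambda>g. m + G *v vec_lambda g)"
proof -
  let ?T = "\<lambda>x. m + G *v x"
  have T: "?T \<in> borel_measurable borel"
    by (intro borel_measurable_continuous_onI continuous_intros)
  have mvn: "(\<lambda>x. ennreal (mvn_density m S x)) \<in> borel_measurable borel"
  proof -
    have "(\<lambda>x. mvn_density m S x) \<in> borel_measurable borel"
      unfolding mvn_density_def divide_inverse
      by (intro borel_measurable_continuous_onI continuous_intros
          bounded_linear.continuous_on[OF matrix_vector_mul_bounded_linear])
    then show ?thesis by measurable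
  qed
  have detS: "det S = (det G)\<^sup>2"
    by (simp add: S det_mul power2_eq_square)
  have quad: "(G *v z) \<bullet> (matrix_inv S *v (G *v z)) = z \<bullet> z" for z
  proof -
    have "det (transpose G) \<noteq> 0" and "det S \<noteq> 0"
      using det by (auto simp: detS)
    note G' = matrix_inv_mult[OF this(1)] and S' = matrix_inv_mult[OF this(2)]
    \<comment> \<open>The value of \<open>matrix_inv S\<close> at \<open>G *v z\<close> is found by
      exhibiting its preimage under \<open>S\<close>, with no formula for the inverse of a
      product.\<close>
    have "S *v (matrix_inv (transpose G) *v z) = G *v z"
      by (simp add: S matrix_vector_mul_assoc matrix_mul_assoc[symmetric] G')
    then have "matrix_inv S *v (G *v z) = matrix_inv (transpose G) *v z"
      using S'(2) by (metis matrix_vector_mul_assoc matrix_vector_mul_lid)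
    moreover have "(G *v z) \<bullet> y = z \<bullet> (transpose G *v y)" for y
      by (metis dot_lmul_matrix inner_commute transpose_matrix_vector)
    moreover have "transpose G *v (matrix_inv (transpose G) *v z) = z"
      by (simp only: matrix_vector_mul_assoc G' matrix_vector_mul_lid)
    ultimately show ?thesis
      by simp
  qed
  \<comment> \<open>Here \<open>sqrt (det S)\<close> equals \<open>\<bar>det G\<bar>\<close>, which
    cancels the Jacobian and leaves the product of one-dimensional densities.\<close>
  have dens: "\<bar>det G\<bar> * mvn_density m S (?T z) = (\<Prod>i\<in>UNIV. std_normal_density (z $ i))" for z
    using det by (simp add: mvn_density_def prod_std_normal_density quad detS real_sqrt_mult)
  have "density lborel (\<lambda>x. ennreal (mvn_density m S x))
      = density (distr lborel borel ?T) (\<lambda>x. ennreal \<bar>det G\<bar> * ennreal (mvn_density m S x))"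
    by (subst lborel_affine_matrix[OF det, of m], subst density_density_eq) (use mvn in auto)
  also have "\<dots> = distr (density lborel (\<lambda>z. ennreal \<bar>det G\<bar> * ennreal (mvn_density m S (?T z)))) borel ?T"
    by (subst density_distr) (use mvn T in auto)
  also have "(\<lambda>z. ennreal \<bar>det G\<bar> * ennreal (mvn_density m S (?T z)))
      = (\<lambda>z. \<Prod>i\<in>UNIV. ennreal (std_normal_density (z $ i)))"
    by (simp add: dens prod_ennreal flip: ennreal_mult')
  also have "distr (density lborel (\<lambda>z. \<Prod>i\<in>UNIV. ennreal (std_normal_density (z $ i)))) borel ?T
      = distr (distr (\<Pi>\<^sub>M i\<in>UNIV. std_normal_distribution) borel vec_lambda) borel ?T"
    by (simp add: distr_std_normal_vec)
  also have "\<dots> = distr (\<Pi>\<^sub>M i\<in>UNIV. std_normal_distribution) borel (\<lambda>g. ?T (vec_lambda g))"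
  proof -
    have "vec_lambda \<in> (\<Pi>\<^sub>M i\<in>(UNIV::'n set). std_normal_distribution) \<rightarrow>\<^sub>M (borel :: (real^'n) measure)"
      by (rule measurable_vec_lambda) simp
    then show ?thesis
      using T by (simp add: distr_distr o_def)
  qed
  finally show ?thesis .
qed

section \<open>The law of the quadratic form\<close>

theorem lemma5:
  fixes M :: "'a measure" and X :: "'a \<Rightarrow> real^'n"
    and m c :: "real^'n" and \<Sigma> A P :: "real^'n^'n"
    and \<rho> :: real and \<omega> \<nu> :: "'n \<Rightarrow> real"
    and M' :: "'b measure" and W :: "'n \<Rightarrow> 'b \<Rightarrow> real"
  assumes "prob_space M"
    and "sym_posdef \<Sigma>"
    and "gaussian_vector M X m \<Sigma>"
    and "sym_posdef A"
    and "\<rho> > 0"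
    and "orthogonal_matrix P"
    and "\<And>i. \<omega> i > 0"
    and "posdef_sqrt \<Sigma> ** A ** posdef_sqrt \<Sigma> = P ** diag_matrix \<omega> ** transpose P"
    and "(\<chi> i. \<nu> i) = transpose P *v (matrix_inv (posdef_sqrt \<Sigma>) *v (m - c))"
    and "prob_space M'"
    and "prob_space.indep_vars M' (\<lambda>_. borel) W UNIV"
    and "\<And>i. distr M' borel (W i) = noncentral_chi_square1 ((\<nu> i)\<^sup>2)"
  shows "measure M {\<xi> \<in> space M. X \<xi> \<in> ellipsoid A c \<rho>}
           = cdf (distr M' borel (\<lambda>\<xi>. \<Sum>i\<in>UNIV. \<omega> i * W i \<xi>)) \<rho>"
proof -
  define R where "R = posdef_sqrt \<Sigma>"
  note R = posdef_sqrt[OF assms(2), folded R_def]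
  have symR: "transpose R = R"
    using R(1) by (simp add: sym_posdef_def)
  have detR: "det R \<noteq> 0"
    by (rule sym_posdef_det_nonzero[OF R(1)])
  have P: "transpose P ** P = mat 1" "P ** transpose P = mat 1"
    using assms(6) by (auto simp: orthogonal_matrix_def)
  define G where "G = R ** P"
  have detG: "det G \<noteq> 0"
    using detR det_orthogonal_matrix[OF assms(6)] by (auto simp: G_def det_mul)
  have \<Sigma>: "\<Sigma> = G ** transpose G"
  proof -
    have "G ** transpose G = R ** (P ** transpose P) ** R"
      by (simp add: G_def matrix_transpose_mul symR matrix_mul_assoc)
    then show ?thesis
      using P R by simp
  qed
  define v where "v = (\<chi> i. \<nu> i)"
  have Gv: "G *v v = m - c"
  proof -
    have "G *v v = (R ** (P ** transpose P) ** matrix_inv R) *v (m - c)"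
      unfolding v_def assms(9) G_def R_def by (simp add: matrix_vector_mul_assoc matrix_mul_assoc)
    then show ?thesis
      by (simp add: P matrix_inv_mult[OF detR])
  qed
  have GAG: "transpose G ** A ** G = diag_matrix \<omega>"
  proof -
    have "transpose G ** A ** G = transpose P ** (R ** A ** R) ** P"
      by (simp add: G_def matrix_transpose_mul symR matrix_mul_assoc)
    also have "\<dots> = (transpose P ** P) ** diag_matrix \<omega> ** (transpose P ** P)"
      unfolding R_def assms(8) by (simp add: matrix_mul_assoc)
    finally show ?thesis by (simp add: P)
  qed
  have quad: "m + G *v z \<in> ellipsoid A c \<rho> \<longleftrightarrow> (\<Sum>i\<in>UNIV. \<omega> i * (z $ i + \<nu> i)\<^sup>2) \<le> \<rho>" for z
  proof -
    have "m + G *v z - c = G *v (z + v)"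
      by (simp add: matrix_vector_right_distrib Gv)
    moreover have "(G *v y) \<bullet> (A *v (G *v y)) = y \<bullet> ((transpose G ** A ** G) *v y)" for y
      by (metis dot_lmul_matrix inner_commute matrix_vector_mul_assoc transpose_matrix_vector)
    moreover have "y \<bullet> (diag_matrix \<omega> *v y) = (\<Sum>i\<in>UNIV. \<omega> i * (y $ i)\<^sup>2)" for y :: "real^'n"
    proof -
      have "(diag_matrix \<omega> *v y) $ i = \<omega> i * y $ i" for i
        by (simp add: diag_matrix_def matrix_vector_mult_def if_distrib[where f = "\<lambda>x. x * _"]
            cong: if_cong)
      then show ?thesis
        by (simp add: inner_vec_def power2_eq_square mult_ac)
    qed
    ultimately show ?thesis
      by (simp add: ellipsoid_def GAG v_def)
  qed
  let ?N = "\<Pi>\<^sub>M i\<in>(UNIV::'n set). std_normal_distribution"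
  \<comment> \<open>The common value of both sides: the event, among independent standard normal
    coordinates, that the diagonalised form is at most \<rho>.\<close>
  let ?E = "{g \<in> space ?N. (\<Sum>i\<in>UNIV. \<omega> i * (g i + \<nu> i)\<^sup>2) \<le> \<rho>}"
  have X: "distr M lborel X = distr ?N borel (\<lambda>g. m + G *v vec_lambda g)" "X \<in> M \<rightarrow>\<^sub>M borel"
    using assms(3) density_mvn_eq_distr[OF detG \<Sigma>, of m]
    by (auto simp: gaussian_vector_def distributed_def)
  have ell: "ellipsoid A c \<rho> \<in> sets borel"
    unfolding ellipsoid_def
    by (intro borel_closed closed_Collect_le continuous_intros
        bounded_linear.continuous_on[OF matrix_vector_mul_bounded_linear])
  have vec_lambda_N: "vec_lambda \<in> ?N \<rightarrow>\<^sub>M (borel :: (real^'n) measure)"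
    by (rule measurable_vec_lambda) simp
  have affine_N: "(\<lambda>g. m + G *v vec_lambda g) \<in> ?N \<rightarrow>\<^sub>M borel"
    by (rule measurable_compose[OF vec_lambda_N])
       (intro borel_measurable_continuous_onI continuous_intros)
  have "measure M {\<xi> \<in> space M. X \<xi> \<in> ellipsoid A c \<rho>} = measure (distr M lborel X) (ellipsoid A c \<rho>)"
    using X(2) ell by (subst measure_distr) (auto intro!: arg_cong2[where f = measure])
  also have "\<dots> = measure ?N ?E"
    unfolding X(1) using affine_N ell
    by (subst measure_distr) (auto simp: quad intro!: arg_cong2[where f = measure])
  finally have lhs: "measure M {\<xi> \<in> space M. X \<xi> \<in> ellipsoid A c \<rho>} = measure ?N ?E" .

  let ?h = "\<lambda>w. \<Sum>i\<in>UNIV. \<omega> i * w i" and ?C = "\<Pi>\<^sub>M i\<in>(UNIV::'n set). (borel :: real measure)"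
  interpret M': prob_space M' by fact
  have W: "W i \<in> M' \<rightarrow>\<^sub>M borel" for i
    using assms(11) by (auto simp: M'.indep_vars_def)
  have h: "?h \<in> ?C \<rightarrow>\<^sub>M borel"
    by measurable
  have "distr M' ?C (\<lambda>\<xi>. \<lambda>i\<in>UNIV. W i \<xi>) = (\<Pi>\<^sub>M i\<in>UNIV. distr M' borel (W i))"
    using M'.indep_vars_iff_distr_eq_PiM'[where I = UNIV and M' = "\<lambda>_. borel" and X = W] W assms(11) by auto
  \<comment> \<open>The \<nu> \<open>i\<close> may be negative, while the distribution is defined
    through \<open>sqrt\<close>; reflection symmetry of the normal law allows the signed
    shift.\<close>
  also have "\<dots> = (\<Pi>\<^sub>M i\<in>UNIV. distr std_normal_distribution borel (\<lambda>g. (g + \<nu> i)\<^sup>2))"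
    by (simp add: assms(12) noncentral_chi_square1_power2)
  finally have joint: "distr M' ?C (\<lambda>\<xi> i. W i \<xi>) = (\<Pi>\<^sub>M i\<in>UNIV. distr std_normal_distribution borel (\<lambda>g. (g + \<nu> i)\<^sup>2))"
    by (simp add: restrict_UNIV)
  have psf: "product_sigma_finite (\<lambda>i::'n. std_normal_distribution)"
    "product_sigma_finite (\<lambda>i. distr std_normal_distribution borel (\<lambda>g. (g + \<nu> i)\<^sup>2))"
    by (intro product_sigma_finite.intro prob_space_imp_sigma_finite prob_space.prob_space_distr
        prob_space_normal_density; simp)+
  \<comment> \<open>The joint law of the \<open>W i\<close> is now an image of the same product of
    normals that carries \<open>X\<close>, so the weighted sum can be evaluated there.\<close>
  have sq: "(\<lambda>g i. (g i + \<nu> i)\<^sup>2) \<in> ?N \<rightarrow>\<^sub>M ?C"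
    and joint': "(\<Pi>\<^sub>M i\<in>UNIV. distr std_normal_distribution borel (\<lambda>g. (g + \<nu> i)\<^sup>2))
      = distr ?N ?C (\<lambda>g i. (g i + \<nu> i)\<^sup>2)"
    using PiM_distr[where I = UNIV, OF finite _ psf] by (simp_all add: restrict_UNIV)
  have W': "(\<lambda>\<xi> i. W i \<xi>) \<in> M' \<rightarrow>\<^sub>M ?C"
    using measurable_restrict[of UNIV W M' "\<lambda>_. borel"] W by (simp add: restrict_UNIV)
  have "distr M' borel (\<lambda>\<xi>. ?h (\<lambda>i. W i \<xi>)) = distr (distr M' ?C (\<lambda>\<xi> i. W i \<xi>)) borel ?h"
    using distr_distr[OF h W'] by (simp add: o_def)
  also have "\<dots> = distr ?N borel (\<lambda>g. ?h (\<lambda>i. (g i + \<nu> i)\<^sup>2))"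
    unfolding joint joint' using distr_distr[OF h sq] by (simp add: o_def)
  finally have "cdf (distr M' borel (\<lambda>\<xi>. ?h (\<lambda>i. W i \<xi>))) \<rho>
      = measure (distr ?N borel (\<lambda>g. ?h (\<lambda>i. (g i + \<nu> i)\<^sup>2))) {..\<rho>}"
    by (simp only: cdf_def)
  also have "\<dots> = measure ?N ?E"
    using measurable_compose[OF sq h]
    by (subst measure_distr) (auto intro!: arg_cong2[where f = measure])
  finally have "cdf (distr M' borel (\<lambda>\<xi>. ?h (\<lambda>i. W i \<xi>))) \<rho> = measure ?N ?E" .
  with lhs show ?thesis by simp
qed

end
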